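(* Consider a feed-forward fully connected Bayesian neural network with layers $1,\dots,L$ whose weights and biases are all independent with common prior distribution $\mathcal{N}(0,\sigma_w^2)$, where $\sigma_w^2>0$ is fixed, and whose nonlinearity $\phi:\mathbb{R}\to\mathbb{R}$ satisfies the extended envelope property. Fix an input $x\in\mathbb{R}^N$. Then, conditional on $x$, for every $1\le \ell\le L$ and every $1\le m\le H_\ell$, the marginal prior distribution induced by forward propagation on the unit $U_m^{(\ell)}$, where $U_m^{(\ell)}$ is either the pre-nonlinearity $g_m^{(\ell)}$ or the post-nonlinearity $h_m^{(\ell)}$, is sub-Weibull with optimal tail parameter $\theta=\ell/2$. That is, $U_m^{(\ell)}\sim \mathrm{subW}(\ell/2)$ and $\|U_m^{(\ell)}\|_k\asymp k^{\ell/2}$.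
   Context: Network: $L\ge 1$ and the widths $H_0=N,H_1,\dots,H_L\ge 1$ are fixed finite integers. For an input $x\in\mathbb{R}^N$ set $h^{(0)}(x)=x$ and, for $1\le \ell\le L$, $g^{(\ell)}(x)=W^{(\ell)}h^{(\ell-1)}(x)$ and $h^{(\ell)}(x)=\phi(g^{(\ell)}(x))$, with $\phi$ applied element-wise. The weight matrix $W^{(\ell)}$ includes the bias vector, i.e. $h^{(\ell-1)}$ is understood to be augmented with a constant coordinate equal to $1$; in coordinates, $g^{(\ell)}_m=b^{(\ell)}_m+\sum_{i=1}^{H_{\ell-1}}W^{(\ell)}_{m,i}h^{(\ell-1)}_i$ and $h^{(\ell)}_m=\phi(g^{(\ell)}_m)$. The $g^{(\ell)}_m$ are called pre-nonlinearities and the $h^{(\ell)}_m$ post-nonlinearities. All weights and biases, over all layers, are independent $\mathcal{N}(0,\sigma_w^2)$ random variables. The marginal prior distribution of a unit is its own distribution (all other units integrated out) for the fixed input $x$. Extended envelope property: a (Borel measurable) function $\phi:\mathbb{R}\to\mathbb{R}$ obeys it if there exist $c_1,c_2\ge 0$ and $d_1,d_2>0$ such that $|\phi(u)|\ge c_1+d_1|u|$ either for all $u\in\mathbb{R}_+$ or for all $u\in\mathbb{R}_-$, and $|\phi(u)|\le c_2+d_2|u|$ for all $u\in\mathbb{R}$. Norms and asymptotic equivalence: $\|X\|_k=(\mathbb{E}[|X|^k])^{1/k}$. For two sequences, $a_k\asymp b_k$ means that there exist constants $d,D>0$ (independent of $k$) such that $d\le a_k/b_k\le D$ for all $k\in\mathbb{N}$,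 $k\ge 1$. Sub-Weibull: for $\theta>0$, a random variable $X$ is sub-Weibull with tail parameter $\theta$, written $X\sim\mathrm{subW}(\theta)$, if there exist constants $a,K>0$ such that $\mathbb{P}(|X|\ge x)\le a\exp(-x^{1/\theta}/K)$ for all $x>0$. $X$ is sub-Weibull with optimal tail parameter $\theta$ if $\|X\|_k\asymp k^\theta$ (this implies $X\sim\mathrm{subW}(\theta)$ and that $X$ is not $\mathrm{subW}(\theta')$ for any $\theta'<\theta$). *)

theory Defs
  imports "HOL-Probability.Probability"
begin

text \<open>
  Units of layer \<open>l\<close> are numbered \<open>1, ..., H l\<close>, and \<open>H 0\<close> is the input dimension.
  A realisation of the parameters is a function \<open>w\<close>, where \<open>w l m i\<close> is the entry of the
  layer-\<open>l\<close> weight matrix in row \<open>m\<close> and column \<open>i\<close>.  Column \<open>0\<close> is the bias vector; it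
  multiplies the constant coordinate \<open>1\<close> that augments the previous layer.
\<close>

definition affine :: "nat \<Rightarrow> (nat \<Rightarrow> nat \<Rightarrow> real) \<Rightarrow> (nat \<Rightarrow> real) \<Rightarrow> nat \<Rightarrow> real" where
  "affine n A h m = A m 0 + (\<Sum>i=1..n. A m i * h i)"

primrec post_nonlin ::
  "(real \<Rightarrow> real) \<Rightarrow> (nat \<Rightarrow> nat) \<Rightarrow> (nat \<Rightarrow> real) \<Rightarrow> (nat \<Rightarrow> nat \<Rightarrow> nat \<Rightarrow> real) \<Rightarrow> nat \<Rightarrow> nat \<Rightarrow> real"
where
  "post_nonlin \<phi> H x w 0 = x"
| "post_nonlin \<phi> H x w (Suc l) =
     (\<lambda>m. \<phi> (affine (H l) (w (Suc l)) (post_nonlin \<phi> H x w l) m))"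

text \<open>Only meaningful for \<open>l \<ge> 1\<close>: the input layer has no pre-nonlinearity.\<close>

definition pre_nonlin ::
  "(real \<Rightarrow> real) \<Rightarrow> (nat \<Rightarrow> nat) \<Rightarrow> (nat \<Rightarrow> real) \<Rightarrow> (nat \<Rightarrow> nat \<Rightarrow> nat \<Rightarrow> real) \<Rightarrow> nat \<Rightarrow> nat \<Rightarrow> real"
where
  "pre_nonlin \<phi> H x w l = affine (H (l - 1)) (w l) (post_nonlin \<phi> H x w (l - 1))"

lemma post_nonlin_eq:
  "l \<ge> 1 \<Longrightarrow> post_nonlin \<phi> H x w l m = \<phi> (pre_nonlin \<phi> H x w l m)"
  by (cases l) (simp_all add: pre_nonlin_def)

definition param_indices :: "nat \<Rightarrow> (nat \<Rightarrow> nat) \<Rightarrow> (nat \<times> nat \<times> nat) set" where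
  "param_indices L H = {(l, m, i). l \<in> {1..L} \<and> m \<in> {1..H l} \<and> i \<in> {0..H (l - 1)}}"

definition extended_envelope :: "(real \<Rightarrow> real) \<Rightarrow> bool" where
  "extended_envelope \<phi> \<longleftrightarrow>
     (\<exists>c1 c2 d1 d2. c1 \<ge> 0 \<and> c2 \<ge> 0 \<and> d1 > 0 \<and> d2 > 0 \<and>
        ((\<forall>u\<ge>0. \<bar>\<phi> u\<bar> \<ge> c1 + d1 * \<bar>u\<bar>) \<or> (\<forall>u\<le>0. \<bar>\<phi> u\<bar> \<ge> c1 + d1 * \<bar>u\<bar>)) \<and>
        (\<forall>u. \<bar>\<phi> u\<bar> \<le> c2 + d2 * \<bar>u\<bar>))"

text \<open>
  The Bochner integral of a non-integrable function is \<open>0\<close>, so \<open>Lnorm M X k = 0\<close> when the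
  \<open>k\<close>-th absolute moment is infinite.  The positive lower bound in \<open>asymp_equivalent\<close> below
  excludes this value, so \<open>sub_weibull_optimal\<close> entails that all absolute moments are finite.
\<close>

definition Lnorm :: "'a measure \<Rightarrow> ('a \<Rightarrow> real) \<Rightarrow> nat \<Rightarrow> real" where
  "Lnorm M X k = (\<integral>\<omega>. \<bar>X \<omega>\<bar> ^ k \<partial>M) powr (1 / real k)"

definition asymp_equivalent :: "(nat \<Rightarrow> real) \<Rightarrow> (nat \<Rightarrow> real) \<Rightarrow> bool" where
  "asymp_equivalent a b \<longleftrightarrow> (\<exists>d>0. \<exists>D>0. \<forall>k\<ge>1. d \<le> a k / b k \<and> a k / b k \<le> D)"

definition sub_weibull :: "'a measure \<Rightarrow> ('a \<Rightarrow> real) \<Rightarrow> real \<Rightarrow> bool" where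
  "sub_weibull M X \<theta> \<longleftrightarrow> \<theta> > 0 \<and> X \<in> borel_measurable M \<and>
     (\<exists>a>0. \<exists>K>0. \<forall>x>0.
        measure M {\<omega> \<in> space M. \<bar>X \<omega>\<bar> \<ge> x} \<le> a * exp (- (x powr (1 / \<theta>)) / K))"

definition sub_weibull_optimal :: "'a measure \<Rightarrow> ('a \<Rightarrow> real) \<Rightarrow> real \<Rightarrow> bool" where
  "sub_weibull_optimal M X \<theta> \<longleftrightarrow> \<theta> > 0 \<and> X \<in> borel_measurable M \<and>
     asymp_equivalent (Lnorm M X) (\<lambda>k. real k powr \<theta>)"

end

theory Submission
  imports Defs
begin

text \<open>
  Conditionally on all layers up to \<open>l\<close>, a pre-nonlinearity of layer \<open>l + 1\<close> is a centred Gaussian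
  with standard deviation \<open>\<sigma> s\<close>, where \<open>s\<close> is the Euclidean norm of the layer-\<open>l\<close> post-nonlinearities
  augmented with the constant \<open>1\<close>.  Hence its \<open>k\<close>-th absolute moment is exactly
  \<open>\<sigma>\<^sup>k E[s\<^sup>k] E[|Z|\<^sup>k]\<close> with \<open>Z\<close> standard normal, and \<open>Z\<close> contributes a factor of order \<open>sqrt k\<close> to
  the \<open>L\<^sup>k\<close> norm.  By the envelope property \<open>\<phi>\<close> preserves this order: the bound from below is
  needed on one half-line only, since each half-line carries a Gaussian moment of full order.
  The constant coordinate makes \<open>s \<ge> 1\<close>, which starts the induction for every input.  The tail
  bound follows from Markov's inequality with \<open>k\<close> proportional to \<open>x powr (1 / \<theta>)\<close>.
\<close>

section \<open>Growth of absolute moments\<close>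

text \<open>The extended nonnegative integral encodes finiteness together with the bound, so no
  integrability has to be carried along. Comparing k-th powers instead of k-th roots lets
  expectations be added and multiplied directly.\<close>

definition moment_upper :: "'a measure \<Rightarrow> ('a \<Rightarrow> real) \<Rightarrow> real \<Rightarrow> bool" where
  "moment_upper M X \<theta> \<longleftrightarrow>
     (\<exists>C>0. \<forall>k\<ge>1. (\<integral>\<^sup>+\<omega>. ennreal (\<bar>X \<omega>\<bar> ^ k) \<partial>M) \<le> ennreal ((C * real k powr \<theta>) ^ k))"

text \<open>An infinite moment satisfies this bound; finiteness comes from
  \<open>moment_upper\<close>.\<close>

definition moment_lower :: "'a measure \<Rightarrow> ('a \<Rightarrow> real) \<Rightarrow> real \<Rightarrow> bool" where
  "moment_lower M X \<theta> \<longleftrightarrow>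
     (\<exists>c>0. \<forall>k\<ge>1. ennreal ((c * real k powr \<theta>) ^ k) \<le> (\<integral>\<^sup>+\<omega>. ennreal (\<bar>X \<omega>\<bar> ^ k) \<partial>M))"

text \<open>Only the two pure terms of the binomial expansion are kept. It merges two moment
  constants: C^k + D^k is at most (C + D)^k.\<close>

lemma add_power_le_power_add:
  fixes a b :: real
  assumes "a \<ge> 0" "b \<ge> 0" "k \<ge> 1"
  shows "a ^ k + b ^ k \<le> (a + b) ^ k"
  using assms(3)
proof (induction k rule: nat_induct_at_least)
  case (Suc n)
  have "a ^ Suc n + b ^ Suc n \<le> (a + b) * (a ^ n + b ^ n)"
    using assms by (simp add: algebra_simps)
  also have "\<dots> \<le> (a + b) * (a + b) ^ n"
    using Suc assms by (intro mult_left_mono) auto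
  finally show ?case by simp
qed simp

text \<open>The sum is at most twice the maximum. The factor 2^k is harmless, because a moment bound
  absorbs anything exponential in \<open>k\<close> into its constant.\<close>

lemma power_add_le_two_power:
  fixes a b :: real
  assumes "a \<ge> 0" "b \<ge> 0"
  shows "(a + b) ^ k \<le> 2 ^ k * (a ^ k + b ^ k)"
proof -
  have "(a + b) ^ k \<le> (2 * max a b) ^ k"
    using assms by (intro power_mono) auto
  also have "\<dots> = 2 ^ k * max a b ^ k"
    by (simp add: power_mult_distrib)
  also have "\<dots> \<le> 2 ^ k * (a ^ k + b ^ k)"
    using assms by (intro mult_left_mono) (auto simp: max_def)
  finally show ?thesis .
qed

section \<open>Closure of moment bounds under comparison, sums and constants\<close>

lemma moment_upper_mono:
  assumes "moment_upper M X \<theta>" "X \<in> borel_measurable M" "c > 0"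
    and le: "\<And>\<omega>. \<omega> \<in> space M \<Longrightarrow> \<bar>Y \<omega>\<bar> \<le> c * \<bar>X \<omega>\<bar>"
  shows "moment_upper M Y \<theta>"
proof -
  note [measurable] = assms(2)
  from assms(1) obtain C where C: "C > 0"
    "\<And>k. k \<ge> 1 \<Longrightarrow> (\<integral>\<^sup>+\<omega>. ennreal (\<bar>X \<omega>\<bar> ^ k) \<partial>M) \<le> ennreal ((C * real k powr \<theta>) ^ k)"
    unfolding moment_upper_def by blast
  have "(\<integral>\<^sup>+\<omega>. ennreal (\<bar>Y \<omega>\<bar> ^ k) \<partial>M) \<le> ennreal ((c * C * real k powr \<theta>) ^ k)"
    if "k \<ge> 1" for k
  proof -
    have "(\<integral>\<^sup>+\<omega>. ennreal (\<bar>Y \<omega>\<bar> ^ k) \<partial>M) \<le> (\<integral>\<^sup>+\<omega>. ennreal (c ^ k) * ennreal (\<bar>X \<omega>\<bar> ^ k) \<partial>M)"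
    proof (intro nn_integral_mono)
      fix \<omega> assume "\<omega> \<in> space M"
      then have "\<bar>Y \<omega>\<bar> ^ k \<le> (c * \<bar>X \<omega>\<bar>) ^ k"
        by (intro power_mono le) auto
      then show "ennreal (\<bar>Y \<omega>\<bar> ^ k) \<le> ennreal (c ^ k) * ennreal (\<bar>X \<omega>\<bar> ^ k)"
        using \<open>c > 0\<close> by (simp add: ennreal_mult'[symmetric] power_mult_distrib ennreal_leI)
    qed
    also have "\<dots> = ennreal (c ^ k) * (\<integral>\<^sup>+\<omega>. ennreal (\<bar>X \<omega>\<bar> ^ k) \<partial>M)"
      by (intro nn_integral_cmult) measurable
    also have "\<dots> \<le> ennreal (c ^ k) * ennreal ((C * real k powr \<theta>) ^ k)"
      by (intro mult_left_mono C that) auto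
    also have "\<dots> = ennreal ((c * C * real k powr \<theta>) ^ k)"
      using \<open>c > 0\<close> by (simp add: ennreal_mult'[symmetric] power_mult_distrib mult_ac)
    finally show ?thesis .
  qed
  then show ?thesis
    unfolding moment_upper_def using C(1) \<open>c > 0\<close> by (intro exI[of _ "c * C"]) auto
qed

lemma moment_lower_mono:
  assumes "moment_lower M X \<theta>" "X \<in> borel_measurable M" "c > 0"
    and le: "\<And>\<omega>. \<omega> \<in> space M \<Longrightarrow> c * \<bar>X \<omega>\<bar> \<le> \<bar>Y \<omega>\<bar>"
  shows "moment_lower M Y \<theta>"
proof -
  note [measurable] = assms(2)
  from assms(1) obtain C where C: "C > 0"
    "\<And>k. k \<ge> 1 \<Longrightarrow> ennreal ((C * real k powr \<theta>) ^ k) \<le> (\<integral>\<^sup>+\<omega>. ennreal (\<bar>X \<omega>\<bar> ^ k) \<partial>M)"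
    unfolding moment_lower_def by blast
  have "ennreal ((c * C * real k powr \<theta>) ^ k) \<le> (\<integral>\<^sup>+\<omega>. ennreal (\<bar>Y \<omega>\<bar> ^ k) \<partial>M)"
    if "k \<ge> 1" for k
  proof -
    have "ennreal ((c * C * real k powr \<theta>) ^ k) = ennreal (c ^ k) * ennreal ((C * real k powr \<theta>) ^ k)"
      using \<open>c > 0\<close> by (simp add: ennreal_mult'[symmetric] power_mult_distrib mult_ac)
    also have "\<dots> \<le> ennreal (c ^ k) * (\<integral>\<^sup>+\<omega>. ennreal (\<bar>X \<omega>\<bar> ^ k) \<partial>M)"
      by (intro mult_left_mono C that) auto
    also have "\<dots> = (\<integral>\<^sup>+\<omega>. ennreal (c ^ k) * ennreal (\<bar>X \<omega>\<bar> ^ k) \<partial>M)"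
      by (intro nn_integral_cmult[symmetric]) measurable
    also have "\<dots> \<le> (\<integral>\<^sup>+\<omega>. ennreal (\<bar>Y \<omega>\<bar> ^ k) \<partial>M)"
    proof (intro nn_integral_mono)
      fix \<omega> assume "\<omega> \<in> space M"
      then have "(c * \<bar>X \<omega>\<bar>) ^ k \<le> \<bar>Y \<omega>\<bar> ^ k"
        using \<open>c > 0\<close> by (intro power_mono le) auto
      then show "ennreal (c ^ k) * ennreal (\<bar>X \<omega>\<bar> ^ k) \<le> ennreal (\<bar>Y \<omega>\<bar> ^ k)"
        using \<open>c > 0\<close> by (simp add: ennreal_mult'[symmetric] power_mult_distrib ennreal_leI)
    qed
    finally show ?thesis .
  qed
  then show ?thesis
    unfolding moment_lower_def using C(1) \<open>c > 0\<close> by (intro exI[of _ "c * C"]) auto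
qed

text \<open>A crude form of Minkowski's inequality: the triangle inequality for L^k norms up to a
  factor 2, which only changes the constant.\<close>

lemma moment_upper_add:
  assumes "moment_upper M X \<theta>" "moment_upper M Y \<theta>"
    and [measurable]: "X \<in> borel_measurable M" "Y \<in> borel_measurable M"
  shows "moment_upper M (\<lambda>\<omega>. X \<omega> + Y \<omega>) \<theta>"
proof -
  from assms(1) obtain C where C: "C > 0"
    "\<And>k. k \<ge> 1 \<Longrightarrow> (\<integral>\<^sup>+\<omega>. ennreal (\<bar>X \<omega>\<bar> ^ k) \<partial>M) \<le> ennreal ((C * real k powr \<theta>) ^ k)"
    unfolding moment_upper_def by blast
  from assms(2) obtain D where D: "D > 0"
    "\<And>k. k \<ge> 1 \<Longrightarrow> (\<integral>\<^sup>+\<omega>. ennreal (\<bar>Y \<omega>\<bar> ^ k) \<partial>M) \<le> ennreal ((D * real k powr \<theta>) ^ k)"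
    unfolding moment_upper_def by blast
  have "(\<integral>\<^sup>+\<omega>. ennreal (\<bar>X \<omega> + Y \<omega>\<bar> ^ k) \<partial>M) \<le> ennreal ((2 * (C + D) * real k powr \<theta>) ^ k)"
    if "k \<ge> 1" for k
  proof -
    have "(\<integral>\<^sup>+\<omega>. ennreal (\<bar>X \<omega> + Y \<omega>\<bar> ^ k) \<partial>M) \<le>
       (\<integral>\<^sup>+\<omega>. ennreal (2 ^ k) * (ennreal (\<bar>X \<omega>\<bar> ^ k) + ennreal (\<bar>Y \<omega>\<bar> ^ k)) \<partial>M)"
    proof (intro nn_integral_mono)
      fix \<omega>
      have "\<bar>X \<omega> + Y \<omega>\<bar> ^ k \<le> (\<bar>X \<omega>\<bar> + \<bar>Y \<omega>\<bar>) ^ k"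
        by (intro power_mono) auto
      also have "\<dots> \<le> 2 ^ k * (\<bar>X \<omega>\<bar> ^ k + \<bar>Y \<omega>\<bar> ^ k)"
        by (intro power_add_le_two_power) auto
      finally show "ennreal (\<bar>X \<omega> + Y \<omega>\<bar> ^ k) \<le>
          ennreal (2 ^ k) * (ennreal (\<bar>X \<omega>\<bar> ^ k) + ennreal (\<bar>Y \<omega>\<bar> ^ k))"
        by (simp add: ennreal_mult'[symmetric] ennreal_plus[symmetric] ennreal_leI del: ennreal_plus)
    qed
    also have "\<dots> = ennreal (2 ^ k) * ((\<integral>\<^sup>+\<omega>. ennreal (\<bar>X \<omega>\<bar> ^ k) \<partial>M) + (\<integral>\<^sup>+\<omega>. ennreal (\<bar>Y \<omega>\<bar> ^ k) \<partial>M))"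
      by (subst nn_integral_cmult, measurable, subst nn_integral_add, measurable)
    also have "\<dots> \<le> ennreal (2 ^ k) * (ennreal ((C * real k powr \<theta>) ^ k) + ennreal ((D * real k powr \<theta>) ^ k))"
      by (intro mult_left_mono add_mono C D that) auto
    also have "\<dots> = ennreal (2 ^ k * ((C * real k powr \<theta>) ^ k + (D * real k powr \<theta>) ^ k))"
      using C(1) D(1) by (simp add: ennreal_mult'[symmetric] ennreal_plus[symmetric] del: ennreal_plus)
    also have "\<dots> \<le> ennreal (2 ^ k * (C * real k powr \<theta> + D * real k powr \<theta>) ^ k)"
      using C(1) D(1) that by (intro ennreal_leI mult_left_mono add_power_le_power_add) auto
    also have "\<dots> = ennreal ((2 * (C + D) * real k powr \<theta>) ^ k)"
      by (simp add: power_mult_distrib[symmetric] algebra_simps)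
    finally show ?thesis .
  qed
  then show ?thesis
    unfolding moment_upper_def using C(1) D(1) by (intro exI[of _ "2 * (C + D)"]) auto
qed

text \<open>k^\<theta> is at least 1 for nonnegative \<theta>. The constant 1 + |c| stays positive
  for c = 0, as the definition requires.\<close>

lemma (in prob_space) moment_upper_const:
  assumes "\<theta> \<ge> 0"
  shows "moment_upper M (\<lambda>_. c) \<theta>"
proof -
  have "ennreal (\<bar>c\<bar> ^ k) \<le> ennreal (((1 + \<bar>c\<bar>) * real k powr \<theta>) ^ k)" if "k \<ge> 1" for k
  proof (intro ennreal_leI power_mono)
    have "real k powr \<theta> \<ge> 1"
      using that assms by (intro ge_one_powr_ge_zero) auto
    then have "(1 + \<bar>c\<bar>) * 1 \<le> (1 + \<bar>c\<bar>) * real k powr \<theta>"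
      by (intro mult_left_mono) auto
    then show "\<bar>c\<bar> \<le> (1 + \<bar>c\<bar>) * real k powr \<theta>" by simp
  qed auto
  then show ?thesis
    unfolding moment_upper_def by (intro exI[of _ "1 + \<bar>c\<bar>"]) (auto simp: emeasure_space_1)
qed

lemma (in prob_space) moment_upper_sum:
  assumes "finite I" "\<theta> \<ge> 0"
    and "\<And>i. i \<in> I \<Longrightarrow> moment_upper M (X i) \<theta>" "\<And>i. i \<in> I \<Longrightarrow> X i \<in> borel_measurable M"
  shows "moment_upper M (\<lambda>\<omega>. \<Sum>i\<in>I. X i \<omega>) \<theta>"
  using assms(1,3,4)
proof (induction I rule: finite_induct)
  case empty
  then show ?case using moment_upper_const[OF \<open>\<theta> \<ge> 0\<close>] by simp
next
  case (insert i I)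
  have "moment_upper M (\<lambda>\<omega>. X i \<omega> + (\<Sum>i\<in>I. X i \<omega>)) \<theta>"
    using insert by (intro moment_upper_add borel_measurable_sum insert.IH) auto
  then show ?case using insert by simp
qed

text \<open>Deterministic quantities have growth exponent 0; this starts the induction over the
  layers.\<close>

lemma (in prob_space) moment_lower_const:
  assumes "c > 0"
  shows "moment_lower M (\<lambda>_. c) 0"
  unfolding moment_lower_def using assms
  by (intro exI[of _ c]) (auto simp: emeasure_space_1)

section \<open>From moment growth to norms and tails\<close>

text \<open>Take k-th roots in both bounds. The upper one also makes every moment finite, so the
  Bochner integral in \<open>Lnorm\<close> is the true moment and not the default value 0.\<close>

lemma (in prob_space) moment_bounds_imp_sub_weibull_optimal:
  assumes "\<theta> > 0" and [measurable]: "X \<in> borel_measurable M"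
    and "moment_upper M X \<theta>" "moment_lower M X \<theta>"
  shows "sub_weibull_optimal M X \<theta>"
proof -
  from assms(3) obtain C where C: "C > 0"
    "\<And>k. k \<ge> 1 \<Longrightarrow> (\<integral>\<^sup>+\<omega>. ennreal (\<bar>X \<omega>\<bar> ^ k) \<partial>M) \<le> ennreal ((C * real k powr \<theta>) ^ k)"
    unfolding moment_upper_def by blast
  from assms(4) obtain c where c: "c > 0"
    "\<And>k. k \<ge> 1 \<Longrightarrow> ennreal ((c * real k powr \<theta>) ^ k) \<le> (\<integral>\<^sup>+\<omega>. ennreal (\<bar>X \<omega>\<bar> ^ k) \<partial>M)"
    unfolding moment_lower_def by blast
  have root: "(y ^ k) powr (1 / real k) = y" if "k \<ge> 1" "y > 0" for y :: real and k
    using that by (simp add: powr_realpow[symmetric] powr_powr)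
  have "c \<le> Lnorm M X k / real k powr \<theta> \<and> Lnorm M X k / real k powr \<theta> \<le> C" if "k \<ge> 1" for k
  proof -
    define I where "I = (\<integral>\<omega>. \<bar>X \<omega>\<bar> ^ k \<partial>M)"
    have pos: "real k powr \<theta> > 0" using that by simp
    have "integrable M (\<lambda>\<omega>. \<bar>X \<omega>\<bar> ^ k)"
      using C(2)[OF that] by (intro integrableI_nonneg) (auto simp: less_top[symmetric] top_unique)
    then have I: "(\<integral>\<^sup>+\<omega>. ennreal (\<bar>X \<omega>\<bar> ^ k) \<partial>M) = ennreal I"
      unfolding I_def by (intro nn_integral_eq_integral) auto
    have "I \<ge> 0" unfolding I_def by simp
    have up: "I \<le> (C * real k powr \<theta>) ^ k"
      using C(2)[OF that] C(1) unfolding I by (subst (asm) ennreal_le_iff) auto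
    have lo: "(c * real k powr \<theta>) ^ k \<le> I"
      using c(2)[OF that] \<open>I \<ge> 0\<close> unfolding I by (subst (asm) ennreal_le_iff) auto
    have "I powr (1 / real k) \<le> ((C * real k powr \<theta>) ^ k) powr (1 / real k)"
      using up \<open>I \<ge> 0\<close> by (intro powr_mono2) auto
    then have "Lnorm M X k \<le> C * real k powr \<theta>"
      unfolding Lnorm_def I_def[symmetric] using that C(1) pos by (subst (asm) root) auto
    moreover have "((c * real k powr \<theta>) ^ k) powr (1 / real k) \<le> I powr (1 / real k)"
      using lo c(1) by (intro powr_mono2) auto
    then have "c * real k powr \<theta> \<le> Lnorm M X k"
      unfolding Lnorm_def I_def[symmetric] using that c(1) pos by (subst (asm) root) auto
    ultimately show ?thesis using pos by (auto simp: field_simps)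
  qed
  then show ?thesis
    unfolding sub_weibull_optimal_def asymp_equivalent_def using assms(1,2) C(1) c(1) by blast
qed

text \<open>Markov's inequality for the k-th moment bounds the tail by (C k^\<theta> / x)^k. With x
  = C e t^\<theta> and \<open>k\<close> the integer part of \<open>t\<close>, the base is at most
  1/e, so the tail is at most e^(-k) \<le> e^(1 - t). The rounding costs a factor e, which becomes
  the constant in front.\<close>

lemma (in prob_space) moment_upper_imp_sub_weibull:
  assumes "\<theta> > 0" and [measurable]: "X \<in> borel_measurable M" and "moment_upper M X \<theta>"
  shows "sub_weibull M X \<theta>"
proof -
  from assms(3) obtain C where C: "C > 0"
    "\<And>k. k \<ge> 1 \<Longrightarrow> (\<integral>\<^sup>+\<omega>. ennreal (\<bar>X \<omega>\<bar> ^ k) \<partial>M) \<le> ennreal ((C * real k powr \<theta>) ^ k)"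
    unfolding moment_upper_def by blast
  \<comment> \<open>The value of \<open>K\<close> for which t = x^(1/\<theta>) / K solves x = C e
    t^\<theta>.\<close>
  define K where "K = (C * exp 1) powr (1 / \<theta>)"
  have K: "K > 0" using C(1) by (simp add: K_def)
  have "measure M {\<omega> \<in> space M. \<bar>X \<omega>\<bar> \<ge> x} \<le> exp 1 * exp (- (x powr (1 / \<theta>)) / K)"
    if x: "x > 0" for x
  proof -
    define t where "t = x powr (1 / \<theta>) / K"
    have t: "t > 0" using x K by (simp add: t_def)
    have xt: "x = C * exp 1 * t powr \<theta>"
      using x C(1) assms(1) by (simp add: t_def K_def powr_divide powr_powr)
    define k where "k = nat \<lfloor>t\<rfloor>"
    have kt: "real k \<le> t" "t < real k + 1" using t by (auto simp: k_def)
    have "measure M {\<omega> \<in> space M. \<bar>X \<omega>\<bar> \<ge> x} \<le> exp (- real k)"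
    \<comment> \<open>For t < 1 the order \<open>k\<close> is 0, where no moment bound is available;
      the claim then says that a probability is at most 1.\<close>
    proof (cases "k \<ge> 1")
      case False
      then have "k = 0" by simp
      then show ?thesis by simp
    next
      case True
      have "emeasure M {\<omega> \<in> space M. \<bar>X \<omega>\<bar> \<ge> x} \<le>
            emeasure M {\<omega> \<in> space M. 1 \<le> ennreal ((1 / x) ^ k) * ennreal (\<bar>X \<omega>\<bar> ^ k)}"
      proof (intro emeasure_mono subsetI)
        fix \<omega> assume "\<omega> \<in> {\<omega> \<in> space M. \<bar>X \<omega>\<bar> \<ge> x}"
        then have "\<omega> \<in> space M" "1 \<le> (1 / x * \<bar>X \<omega>\<bar>) ^ k"
          using x by (auto intro!: one_le_power)
        then show "\<omega> \<in> {\<omega> \<in> space M. 1 \<le> ennreal ((1 / x) ^ k) * ennreal (\<bar>X \<omega>\<bar> ^ k)}"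
          using x by (simp add: ennreal_mult'[symmetric] power_mult_distrib[symmetric] del: power_abs)
      qed measurable
      also have "\<dots> \<le> ennreal ((1 / x) ^ k) * (\<integral>\<^sup>+\<omega>. ennreal (\<bar>X \<omega>\<bar> ^ k) * indicator (space M) \<omega> \<partial>M)"
        using nn_integral_Markov_inequality[of "\<lambda>\<omega>. ennreal (\<bar>X \<omega>\<bar> ^ k)" "space M" M "ennreal ((1 / x) ^ k)"]
        by simp
      also have "\<dots> = ennreal ((1 / x) ^ k) * (\<integral>\<^sup>+\<omega>. ennreal (\<bar>X \<omega>\<bar> ^ k) \<partial>M)"
        by (intro arg_cong2[where f="(*)"] refl nn_integral_cong) simp
      also have "\<dots> \<le> ennreal ((1 / x) ^ k) * ennreal ((C * real k powr \<theta>) ^ k)"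
        by (intro mult_left_mono C True) auto
      also have "\<dots> = ennreal ((1 / x * (C * real k powr \<theta>)) ^ k)"
        using x by (simp add: ennreal_mult'[symmetric] power_mult_distrib power_divide)
      also have "\<dots> \<le> ennreal (exp (-1) ^ k)"
      proof (intro ennreal_leI power_mono)
        have "real k powr \<theta> \<le> t powr \<theta>"
          using kt assms(1) by (intro powr_mono2) auto
        then show "1 / x * (C * real k powr \<theta>) \<le> exp (-1)"
          using C(1) t unfolding xt by (simp add: field_simps exp_minus)
        show "0 \<le> 1 / x * (C * real k powr \<theta>)" using x C(1) by simp
      qed
      also have "exp (-1) ^ k = exp (- real k)"
        by (simp add: exp_of_nat_mult[symmetric])
      finally show ?thesis by (simp add: emeasure_eq_measure)
    qed
    also have "\<dots> \<le> exp (1 - t)" using kt by simp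
    also have "\<dots> = exp 1 * exp (- (x powr (1 / \<theta>)) / K)"
      by (simp add: t_def exp_add[symmetric])
    finally show ?thesis .
  qed
  then show ?thesis
    unfolding sub_weibull_def using assms(1,2) K by (intro conjI exI[of _ "exp 1"] exI[of _ K]) auto
qed

section \<open>Gaussian scale mixtures\<close>

abbreviation std_normal :: "real measure" where
  "std_normal \<equiv> density lborel (\<lambda>z. ennreal (std_normal_density z))"

lemma nn_integral_std_normal:
  assumes "f \<in> borel_measurable borel"
  shows "(\<integral>\<^sup>+z. f z \<partial>std_normal) = (\<integral>\<^sup>+z. ennreal (std_normal_density z) * f z \<partial>lborel)"
  using assms by (intro nn_integral_density) auto

text \<open>Independence makes the joint law a product, and Tonelli integrates out \<open>X\<close>
  with \<open>Y\<close> frozen. This takes the place of conditioning on the earlier layers, without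
  conditional expectations.\<close>

lemma (in prob_space) indep_var_nn_integral:
  assumes "indep_var S X T Y" and f: "f \<in> borel_measurable (S \<Otimes>\<^sub>M T)"
  shows "(\<integral>\<^sup>+\<omega>. f (X \<omega>, Y \<omega>) \<partial>M) = (\<integral>\<^sup>+\<omega>. \<integral>\<^sup>+\<omega>'. f (X \<omega>', Y \<omega>) \<partial>M \<partial>M)"
proof -
  have [measurable]: "X \<in> measurable M S" "Y \<in> measurable M T"
    and eq: "distr M S X \<Otimes>\<^sub>M distr M T Y = distr M (S \<Otimes>\<^sub>M T) (\<lambda>x. (X x, Y x))"
    using assms(1) unfolding indep_var_distribution_eq by auto
  note [measurable] = f
  interpret X: prob_space "distr M S X" by (rule prob_space_distr) measurable
  interpret Y: prob_space "distr M T Y" by (rule prob_space_distr) measurable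
  interpret XY: pair_sigma_finite "distr M S X" "distr M T Y" ..
  have "(\<integral>\<^sup>+\<omega>. f (X \<omega>, Y \<omega>) \<partial>M) = integral\<^sup>N (distr M S X \<Otimes>\<^sub>M distr M T Y) f"
    unfolding eq by (simp add: nn_integral_distr)
  also have "\<dots> = (\<integral>\<^sup>+y. \<integral>\<^sup>+x. f (x, y) \<partial>distr M S X \<partial>distr M T Y)"
    by (intro XY.nn_integral_snd[symmetric]) simp
  also have "\<dots> = (\<integral>\<^sup>+\<omega>. \<integral>\<^sup>+x. f (x, Y \<omega>) \<partial>distr M S X \<partial>M)"
    by (intro nn_integral_distr) measurable
  also have "\<dots> = (\<integral>\<^sup>+\<omega>. \<integral>\<^sup>+\<omega>'. f (X \<omega>', Y \<omega>) \<partial>M \<partial>M)"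
  proof (intro nn_integral_cong)
    fix \<omega> assume "\<omega> \<in> space M"
    then have [measurable]: "Y \<omega> \<in> space T"
      by (meson \<open>Y \<in> measurable M T\<close> measurable_space)
    show "(\<integral>\<^sup>+x. f (x, Y \<omega>) \<partial>distr M S X) = (\<integral>\<^sup>+\<omega>'. f (X \<omega>', Y \<omega>) \<partial>M)"
      by (intro nn_integral_distr) measurable
  qed
  finally show ?thesis .
qed

text \<open>Standardising \<open>X\<close> moves its scale into the argument, so that Gaussians of
  different variances are integrated against one fixed measure.\<close>

lemma (in prob_space) distributed_normal_nn_integral:
  assumes "distributed M lborel X (normal_density 0 \<sigma>)" "\<sigma> > 0" "f \<in> borel_measurable borel"
  shows "(\<integral>\<^sup>+\<omega>. f (X \<omega>) \<partial>M) = (\<integral>\<^sup>+z. f (\<sigma> * z) \<partial>std_normal)"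
proof -
  note [measurable] = assms(3)
  have "distributed M lborel (\<lambda>\<omega>. X \<omega> / \<sigma>) std_normal_density"
    using normal_standard_normal_convert[OF assms(2), of X 0] assms(1) by simp
  from distributed_nn_integral[OF this, of "\<lambda>z. f (\<sigma> * z)"] show ?thesis
    using assms(2) by (simp add: nn_integral_std_normal)
qed

lemma (in prob_space) normal_linear_combination:
  assumes "finite I" "indep_vars (\<lambda>_. borel) V I" "\<sigma> > 0"
    and "\<And>i. i \<in> I \<Longrightarrow> distributed M lborel (V i) (normal_density 0 \<sigma>)"
    and "i0 \<in> I" "a i0 \<noteq> (0::real)"
  shows "distributed M lborel (\<lambda>\<omega>. \<Sum>i\<in>I. V i \<omega> * a i) (normal_density 0 (\<sigma> * sqrt (\<Sum>i\<in>I. (a i)\<^sup>2)))"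
proof -
  \<comment> \<open>A vanishing coefficient would give a degenerate summand without a density. Such
    indices are removed, and \<open>i0\<close> keeps the remaining set nonempty.\<close>
  define J where "J = {i \<in> I. a i \<noteq> 0}"
  have J: "J \<subseteq> I" "finite J" "J \<noteq> {}" using assms by (auto simp: J_def)
  have "distributed M lborel (\<lambda>\<omega>. \<Sum>i\<in>J. a i * V i \<omega>)
          (normal_density (\<Sum>i\<in>J. 0) (sqrt (\<Sum>i\<in>J. (\<bar>a i\<bar> * \<sigma>)\<^sup>2)))"
  proof (rule sum_indep_normal)
    show "indep_vars (\<lambda>_. borel) (\<lambda>i \<omega>. a i * V i \<omega>) J"
      by (rule indep_vars_compose2[OF indep_vars_subset[OF assms(2) J(1)]]) simp
    fix i assume i: "i \<in> J"
    then show "0 < \<bar>a i\<bar> * \<sigma>" using assms(3) by (simp add: J_def)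
    have "distributed M lborel (\<lambda>\<omega>. 0 + a i * V i \<omega>) (normal_density (0 + a i * 0) (\<bar>a i\<bar> * \<sigma>))"
      using i J by (intro normal_density_affine assms) (auto simp: J_def)
    then show "distributed M lborel (\<lambda>\<omega>. a i * V i \<omega>) (normal_density 0 (\<bar>a i\<bar> * \<sigma>))"
      by simp
  qed (use J in auto)
  moreover have "(\<lambda>\<omega>. \<Sum>i\<in>J. a i * V i \<omega>) = (\<lambda>\<omega>. \<Sum>i\<in>I. V i \<omega> * a i)"
  proof
    fix \<omega>
    show "(\<Sum>i\<in>J. a i * V i \<omega>) = (\<Sum>i\<in>I. V i \<omega> * a i)"
      using assms(1) by (intro sum.mono_neutral_cong_left) (auto simp: J_def)
  qed
  moreover have "(\<Sum>i\<in>J. (\<bar>a i\<bar> * \<sigma>)\<^sup>2) = \<sigma>\<^sup>2 * (\<Sum>i\<in>I. (a i)\<^sup>2)"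
    unfolding sum_distrib_left using assms(1)
    by (intro sum.mono_neutral_cong_left) (auto simp: J_def power_mult_distrib)
  ultimately show ?thesis
    using assms(3) by (simp add: real_sqrt_mult)
qed

text \<open>The law of \<open>G\<close> is that of \<open>s\<close> times a standard normal variable
  independent of \<open>s\<close>. Testing against nonnegative Borel functions avoids constructing
  such a variable on \<open>M\<close>.\<close>

definition normal_scale_mixture :: "'a measure \<Rightarrow> ('a \<Rightarrow> real) \<Rightarrow> ('a \<Rightarrow> real) \<Rightarrow> bool" where
  "normal_scale_mixture M G s \<longleftrightarrow>
     G \<in> borel_measurable M \<and> s \<in> borel_measurable M \<and> (\<forall>\<omega>\<in>space M. s \<omega> > 0) \<and>
     (\<forall>f::real \<Rightarrow> ennreal. f \<in> borel_measurable borel \<longrightarrow>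
        (\<integral>\<^sup>+\<omega>. f (G \<omega>) \<partial>M) = (\<integral>\<^sup>+\<omega>. \<integral>\<^sup>+z. f (s \<omega> * z) \<partial>std_normal \<partial>M))"

text \<open>With \<open>Y\<close> frozen the coefficients are numbers, and a linear form in
  independent centred Gaussians is Gaussian with variance \<sigma>^2 times the sum of their squares.
  The index \<open>i0\<close> is the slot of the bias; its coefficient 1 keeps the variance
  positive.\<close>

lemma (in prob_space) normal_scale_mixture_linear_form:
  assumes "finite I" and V: "indep_vars (\<lambda>_. borel) V I" and "\<sigma> > 0"
    and normal: "\<And>i. i \<in> I \<Longrightarrow> distributed M lborel (V i) (normal_density 0 \<sigma>)"
    and indep: "indep_var (PiM I (\<lambda>_. borel)) (\<lambda>\<omega>. \<lambda>i\<in>I. V i \<omega>) T Y"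
    and a[measurable]: "\<And>i. i \<in> I \<Longrightarrow> a i \<in> borel_measurable T"
    and i0: "i0 \<in> I" "\<And>y. a i0 y = (1::real)"
  shows "normal_scale_mixture M (\<lambda>\<omega>. \<Sum>i\<in>I. V i \<omega> * a i (Y \<omega>))
           (\<lambda>\<omega>. \<sigma> * sqrt (\<Sum>i\<in>I. (a i (Y \<omega>))\<^sup>2))"
proof -
  have [measurable]: "Y \<in> measurable M T"
    using indep by (rule indep_var_rv2)
  have [measurable]: "V i \<in> borel_measurable M" if "i \<in> I" for i
    using V that unfolding indep_vars_def by auto
  have pos: "\<sigma> * sqrt (\<Sum>i\<in>I. (a i y)\<^sup>2) > 0" for y
    using \<open>\<sigma> > 0\<close> \<open>finite I\<close> i0
    by (intro mult_pos_pos real_sqrt_gt_zero sum_pos2[of I i0]) auto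
  have "(\<integral>\<^sup>+\<omega>. f (\<Sum>i\<in>I. V i \<omega> * a i (Y \<omega>)) \<partial>M) =
        (\<integral>\<^sup>+\<omega>. \<integral>\<^sup>+z. f (\<sigma> * sqrt (\<Sum>i\<in>I. (a i (Y \<omega>))\<^sup>2) * z) \<partial>std_normal \<partial>M)"
    if [measurable]: "f \<in> borel_measurable borel" for f :: "real \<Rightarrow> ennreal"
  proof -
    let ?F = "\<lambda>(v, y). f (\<Sum>i\<in>I. v i * a i y)"
    have "(\<integral>\<^sup>+\<omega>. f (\<Sum>i\<in>I. V i \<omega> * a i (Y \<omega>)) \<partial>M) = (\<integral>\<^sup>+\<omega>. ?F (\<lambda>i\<in>I. V i \<omega>, Y \<omega>) \<partial>M)"
      by simp
    also have "\<dots> = (\<integral>\<^sup>+\<omega>. \<integral>\<^sup>+\<omega>'. ?F (\<lambda>i\<in>I. V i \<omega>', Y \<omega>) \<partial>M \<partial>M)"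
      by (rule indep_var_nn_integral[OF indep]) measurable
    also have "\<dots> = (\<integral>\<^sup>+\<omega>. \<integral>\<^sup>+z. f (\<sigma> * sqrt (\<Sum>i\<in>I. (a i (Y \<omega>))\<^sup>2) * z) \<partial>std_normal \<partial>M)"
    proof (intro nn_integral_cong)
      fix \<omega>
      have "distributed M lborel (\<lambda>\<omega>'. \<Sum>i\<in>I. V i \<omega>' * a i (Y \<omega>))
             (normal_density 0 (\<sigma> * sqrt (\<Sum>i\<in>I. (a i (Y \<omega>))\<^sup>2)))"
        using assms(1-4) i0 by (intro normal_linear_combination[where ?i0.0 = i0]) auto
      from distributed_normal_nn_integral[OF this pos, of f]
      show "(\<integral>\<^sup>+\<omega>'. ?F (\<lambda>i\<in>I. V i \<omega>', Y \<omega>) \<partial>M) =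
            (\<integral>\<^sup>+z. f (\<sigma> * sqrt (\<Sum>i\<in>I. (a i (Y \<omega>))\<^sup>2) * z) \<partial>std_normal)"
        by simp
    qed
    finally show ?thesis .
  qed
  then show ?thesis
    unfolding normal_scale_mixture_def using pos by auto
qed

section \<open>Absolute moments of the standard normal distribution\<close>

text \<open>Apply u \<le> e^u to u = z^2/(2k), then take square roots and k-th powers. This isolates
  the order k^(k/2) and leaves a factor, independent of \<open>k\<close>, that the Gaussian density
  can absorb.\<close>

lemma power_le_exp_quarter_square:
  assumes "k \<ge> 1"
  shows "\<bar>z::real\<bar> ^ k \<le> sqrt (2 * real k) ^ k * exp (z\<^sup>2 / 4)"
proof -
  have "z\<^sup>2 / (2 * real k) \<le> exp (z\<^sup>2 / (2 * real k))"
    using exp_ge_add_one_self[of "z\<^sup>2 / (2 * real k)"] by linarith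
  then have "sqrt (z\<^sup>2) \<le> sqrt (2 * real k * exp (z\<^sup>2 / (2 * real k)))"
    using assms by (intro real_sqrt_le_mono) (simp add: field_simps)
  then have "\<bar>z\<bar> \<le> sqrt (2 * real k) * sqrt (exp (z\<^sup>2 / (2 * real k)))"
    by (simp add: real_sqrt_mult)
  also have "sqrt (exp (z\<^sup>2 / (2 * real k))) = exp (z\<^sup>2 / (4 * real k))"
    by (rule real_sqrt_unique) (auto simp: exp_of_nat_mult[symmetric] power2_eq_square exp_add[symmetric])
  finally have "\<bar>z\<bar> ^ k \<le> (sqrt (2 * real k) * exp (z\<^sup>2 / (4 * real k))) ^ k"
    by (intro power_mono) auto
  also have "\<dots> = sqrt (2 * real k) ^ k * exp (z\<^sup>2 / 4)"
    using assms by (simp add: power_mult_distrib exp_of_nat_mult[symmetric])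
  finally show ?thesis .
qed

text \<open>The factor e^(z^2/4) turns the standard normal density into sqrt 2 times the centred
  normal density of variance 2, which has total mass 1.\<close>

lemma std_normal_abs_moment_le:
  assumes "k \<ge> 1"
  shows "(\<integral>\<^sup>+z. ennreal (\<bar>z\<bar> ^ k) \<partial>std_normal) \<le> ennreal ((2 * sqrt (real k)) ^ k)"
proof -
  have dens: "std_normal_density z * exp (z\<^sup>2 / 4) = sqrt 2 * normal_density 0 (sqrt 2) z" for z
  proof -
    have "std_normal_density z * exp (z\<^sup>2 / 4) = 1 / sqrt 2 * (exp (- (z\<^sup>2 / 4)) / sqrt pi)"
      by (simp add: normal_density_def real_sqrt_mult exp_add[symmetric])
    also have "1 / sqrt 2 = sqrt 2 / (2::real)"
      using sqrt_divide_self_eq[of 2] by (simp add: inverse_eq_divide)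
    also have "sqrt 2 / 2 * (exp (- (z\<^sup>2 / 4)) / sqrt pi) = sqrt 2 * normal_density 0 (sqrt 2) z"
      by (simp add: normal_density_def real_sqrt_mult)
    finally show ?thesis .
  qed
  have "(\<integral>\<^sup>+z. ennreal (\<bar>z\<bar> ^ k) \<partial>std_normal) =
        (\<integral>\<^sup>+z. ennreal (std_normal_density z) * ennreal (\<bar>z\<bar> ^ k) \<partial>lborel)"
    by (intro nn_integral_std_normal) measurable
  also have "\<dots> \<le> (\<integral>\<^sup>+z. ennreal (sqrt (2 * real k) ^ k * sqrt 2) * ennreal (normal_density 0 (sqrt 2) z) \<partial>lborel)"
  proof (intro nn_integral_mono)
    fix z :: real
    have "std_normal_density z * \<bar>z\<bar> ^ k \<le> std_normal_density z * (sqrt (2 * real k) ^ k * exp (z\<^sup>2 / 4))"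
      by (intro mult_left_mono power_le_exp_quarter_square assms normal_density_nonneg)
    also have "\<dots> = sqrt (2 * real k) ^ k * (std_normal_density z * exp (z\<^sup>2 / 4))"
      by simp
    also have "\<dots> = sqrt (2 * real k) ^ k * sqrt 2 * normal_density 0 (sqrt 2) z"
      unfolding dens by simp
    finally show "ennreal (std_normal_density z) * ennreal (\<bar>z\<bar> ^ k) \<le>
        ennreal (sqrt (2 * real k) ^ k * sqrt 2) * ennreal (normal_density 0 (sqrt 2) z)"
      by (simp add: ennreal_mult'[symmetric] ennreal_leI del: power_abs)
  qed
  also have "\<dots> = ennreal (sqrt (2 * real k) ^ k * sqrt 2) * (\<integral>\<^sup>+z. ennreal (normal_density 0 (sqrt 2) z) \<partial>lborel)"
    by (intro nn_integral_cmult) measurable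
  also have "(\<integral>\<^sup>+z. ennreal (normal_density 0 (sqrt 2) z) \<partial>lborel) = 1"
    by (subst nn_integral_eq_integral) auto
  also have "ennreal (sqrt (2 * real k) ^ k * sqrt 2) * 1 \<le> ennreal ((2 * sqrt (real k)) ^ k)"
  proof -
    \<comment> \<open>The leftover factor sqrt 2 is at most its k-th power, so it can join the
      base.\<close>
    have "sqrt 2 ^ 1 \<le> sqrt 2 ^ k"
      using assms by (intro power_increasing) auto
    then have "sqrt (2 * real k) ^ k * sqrt 2 \<le> sqrt (2 * real k) ^ k * sqrt 2 ^ k"
      by (intro mult_left_mono) auto
    also have "\<dots> = (sqrt (2 * real k) * sqrt 2) ^ k"
      by (simp only: power_mult_distrib)
    also have "sqrt (2 * real k) * sqrt 2 = 2 * sqrt (real k)"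
      by (simp add: real_sqrt_mult)
    finally show ?thesis by (simp add: ennreal_leI)
  qed
  finally show ?thesis .
qed

text \<open>The integral over the unit interval at the moment scale \<open>sqrt k\<close> already has the right order.\<close>

lemma std_normal_half_moment_ge:
  assumes "k \<ge> 1" and A: "A = {0..} \<or> A = {..0}"
  shows "ennreal ((exp (-3) * sqrt (real k)) ^ k) \<le>
         (\<integral>\<^sup>+z. ennreal (\<bar>z\<bar> ^ k) * indicator A z \<partial>std_normal)"
proof -
  define r where "r = sqrt (real k)"
  have r: "r \<ge> 1" "r\<^sup>2 = real k" using assms by (auto simp: r_def)
  \<comment> \<open>On \<open>B\<close>, which is [r, r + 1] or its mirror image, r \<le> |z| \<le>
    2r because r \<ge> 1. So |z|^k has full order k^(k/2), while the density costs only a factor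
    exponential in \<open>k\<close>.\<close>
  define B where "B = (if A = {0..} then {r..r+1} else {-r-1..-r})"
  have BA: "B \<subseteq> A" using A r by (auto simp: B_def)
  have B: "r \<le> \<bar>z\<bar>" "\<bar>z\<bar> \<le> r + 1" if "z \<in> B" for z
    using that r by (auto simp: B_def split: if_splits)
  have [measurable]: "A \<in> sets borel" "B \<in> sets borel" using A by (auto simp: B_def)
  have lB: "emeasure lborel B = 1" by (simp add: B_def)
  \<comment> \<open>The exponent 3 splits as 2 + 1: e^(-2k) bounds e^(-z^2/2) from below for |z|
    \<le> 2r, and e^(-k) \<le> e^(-1) is left for the normalising constant.\<close>
  have "(exp (-3) * r) ^ k = exp (-1) ^ k * (exp (-2) ^ k * r ^ k)"
    by (simp add: power_mult_distrib exp_of_nat_mult[symmetric] exp_add[symmetric] algebra_simps)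
  also have "\<dots> \<le> exp (-1) * (exp (-2) ^ k * r ^ k)"
    using power_decreasing[of 1 k "exp (-1) :: real"] assms r by (intro mult_right_mono) auto
  finally have c: "(exp (-3) * r) ^ k \<le> exp (-1) * exp (-2 * real k) * r ^ k"
    by (simp add: exp_of_nat_mult[symmetric] mult_ac)
  have dens: "std_normal_density z \<ge> exp (-1) * exp (-2 * real k)" if "z \<in> B" for z
  proof -
    have "\<bar>z\<bar>\<^sup>2 \<le> (2 * r)\<^sup>2"
      using B[OF that] r by (intro power_mono) auto
    then have "exp (-2 * real k) \<le> exp (- z\<^sup>2 / 2)"
      using r by (simp add: power_mult_distrib)
    moreover have "exp (-1) \<le> 1 / sqrt (2 * pi)"
    proof -
      \<comment> \<open>Numerically, e is at least 2.6, and 2.6^2 = 6.76 exceeds 2 pi.\<close>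
      have "2 * pi \<le> exp 2"
      proof -
        have "(2.6::real)\<^sup>2 \<le> (exp 1)\<^sup>2"
          using e_approx_32 by (intro power_mono) (auto simp: abs_if split: if_splits)
        moreover have "(exp 1)\<^sup>2 = exp (2::real)"
          by (simp add: power2_eq_square exp_add[symmetric])
        ultimately show ?thesis
          using pi_approx by (simp add: power2_eq_square)
      qed
      then have "sqrt (2 * pi) \<le> sqrt (exp 2)" by simp
      also have "sqrt (exp 2) = exp (1::real)"
        by (rule real_sqrt_unique) (auto simp: power2_eq_square exp_add[symmetric])
      finally show ?thesis by (simp add: exp_minus field_simps)
    qed
    ultimately have "exp (-1) * exp (-2 * real k) \<le> 1 / sqrt (2 * pi) * exp (- z\<^sup>2 / 2)"
      by (intro mult_mono) auto
    then show ?thesis by (simp add: normal_density_def)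
  qed
  have "ennreal ((exp (-3) * r) ^ k) = (\<integral>\<^sup>+z. ennreal ((exp (-3) * r) ^ k) * indicator B z \<partial>lborel)"
    by (subst nn_integral_cmult_indicator) (simp_all add: lB)
  also have "\<dots> \<le> (\<integral>\<^sup>+z. ennreal (std_normal_density z) * (ennreal (\<bar>z\<bar> ^ k) * indicator A z) \<partial>lborel)"
  proof (intro nn_integral_mono)
    fix z :: real
    show "ennreal ((exp (-3) * r) ^ k) * indicator B z \<le>
          ennreal (std_normal_density z) * (ennreal (\<bar>z\<bar> ^ k) * indicator A z)"
    proof (cases "z \<in> B")
      case True
      have "(exp (-3) * r) ^ k \<le> std_normal_density z * \<bar>z\<bar> ^ k"
        using dens[OF True] B[OF True] r
        by (intro order.trans[OF c] mult_mono power_mono) (auto simp: normal_density_nonneg)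
      moreover have "z \<in> A" using True BA by auto
      ultimately show ?thesis
        using True by (simp add: ennreal_mult'[symmetric] ennreal_leI del: power_abs)
    qed simp
  qed
  also have "\<dots> = (\<integral>\<^sup>+z. ennreal (\<bar>z\<bar> ^ k) * indicator A z \<partial>std_normal)"
    by (intro nn_integral_std_normal[symmetric]) measurable
  finally show ?thesis by (simp add: r_def)
qed

section \<open>Moments of Gaussian scale mixtures\<close>

lemma powr_add_half_power:
  assumes "k \<ge> 1"
  shows "(c * real k powr \<theta>) ^ k * (d * sqrt (real k)) ^ k = (c * d * real k powr (\<theta> + 1/2)) ^ k"
proof -
  have "(c * real k powr \<theta>) * (d * sqrt (real k)) = c * d * real k powr (\<theta> + 1/2)"
    using assms by (simp add: powr_add powr_half_sqrt)
  then show ?thesis by (metis power_mult_distrib)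
qed

text \<open>Absolute moments of a product of independent factors multiply, so the exponent 1/2 of
  the Gaussian adds to that of the scale.\<close>

lemma normal_scale_mixture_moment_upper:
  assumes mix: "normal_scale_mixture M G s" and "moment_upper M s \<theta>"
  shows "moment_upper M G (\<theta> + 1/2)"
proof -
  from assms(2) obtain C where C: "C > 0"
    "\<And>k. k \<ge> 1 \<Longrightarrow> (\<integral>\<^sup>+\<omega>. ennreal (\<bar>s \<omega>\<bar> ^ k) \<partial>M) \<le> ennreal ((C * real k powr \<theta>) ^ k)"
    unfolding moment_upper_def by blast
  have [measurable]: "s \<in> borel_measurable M"
    using mix unfolding normal_scale_mixture_def by auto
  have "(\<integral>\<^sup>+\<omega>. ennreal (\<bar>G \<omega>\<bar> ^ k) \<partial>M) \<le> ennreal ((C * 2 * real k powr (\<theta> + 1/2)) ^ k)"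
    if k: "k \<ge> 1" for k
  proof -
    have meas: "(\<lambda>u. ennreal (\<bar>u\<bar> ^ k)) \<in> borel_measurable borel" by measurable
    have "(\<integral>\<^sup>+\<omega>. ennreal (\<bar>G \<omega>\<bar> ^ k) \<partial>M) = (\<integral>\<^sup>+\<omega>. \<integral>\<^sup>+z. ennreal (\<bar>s \<omega> * z\<bar> ^ k) \<partial>std_normal \<partial>M)"
      using mix meas unfolding normal_scale_mixture_def by blast
    also have "\<dots> = (\<integral>\<^sup>+\<omega>. ennreal (\<bar>s \<omega>\<bar> ^ k) * (\<integral>\<^sup>+z. ennreal (\<bar>z\<bar> ^ k) \<partial>std_normal) \<partial>M)"
      by (intro nn_integral_cong, subst nn_integral_cmult[symmetric])
         (auto simp: abs_mult power_mult_distrib ennreal_mult')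
    also have "\<dots> = (\<integral>\<^sup>+\<omega>. ennreal (\<bar>s \<omega>\<bar> ^ k) \<partial>M) * (\<integral>\<^sup>+z. ennreal (\<bar>z\<bar> ^ k) \<partial>std_normal)"
      by (intro nn_integral_multc) measurable
    also have "\<dots> \<le> ennreal ((C * real k powr \<theta>) ^ k) * ennreal ((2 * sqrt (real k)) ^ k)"
      by (intro mult_mono C std_normal_abs_moment_le k) auto
    also have "\<dots> = ennreal ((C * 2 * real k powr (\<theta> + 1/2)) ^ k)"
      using C(1) by (simp only: powr_add_half_power[OF k, symmetric]) (simp add: ennreal_mult')
    finally show ?thesis .
  qed
  then show ?thesis
    unfolding moment_upper_def using C(1) by (intro exI[of _ "C * 2"]) auto
qed

text \<open>Restricting to the half-line where \<phi> grows at least linearly costs only a constant: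
  the restricted moment still factors into the moment of \<open>s\<close> and a Gaussian half-moment
  of full order.\<close>

lemma normal_scale_mixture_moment_lower:
  assumes mix: "normal_scale_mixture M G s" and "moment_lower M s \<theta>"
    and A: "A = {0..} \<or> A = {..0}" and "d > 0" and \<phi>: "\<And>u. u \<in> A \<Longrightarrow> d * \<bar>u\<bar> \<le> \<bar>\<phi> u\<bar>"
  shows "moment_lower M (\<lambda>\<omega>. \<phi> (G \<omega>)) (\<theta> + 1/2)"
proof -
  from assms(2) obtain c where c: "c > 0"
    "\<And>k. k \<ge> 1 \<Longrightarrow> ennreal ((c * real k powr \<theta>) ^ k) \<le> (\<integral>\<^sup>+\<omega>. ennreal (\<bar>s \<omega>\<bar> ^ k) \<partial>M)"
    unfolding moment_lower_def by blast
  have [measurable]: "s \<in> borel_measurable M" "G \<in> borel_measurable M"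
    and s: "\<And>\<omega>. \<omega> \<in> space M \<Longrightarrow> s \<omega> > 0"
    and mix_eq: "\<And>f::real \<Rightarrow> ennreal. f \<in> borel_measurable borel \<Longrightarrow>
      (\<integral>\<^sup>+\<omega>. f (G \<omega>) \<partial>M) = (\<integral>\<^sup>+\<omega>. \<integral>\<^sup>+z. f (s \<omega> * z) \<partial>std_normal \<partial>M)"
    using mix unfolding normal_scale_mixture_def by auto
  have [measurable]: "A \<in> sets borel" using A by auto
  have "ennreal ((d * c * exp (-3) * real k powr (\<theta> + 1/2)) ^ k) \<le> (\<integral>\<^sup>+\<omega>. ennreal (\<bar>\<phi> (G \<omega>)\<bar> ^ k) \<partial>M)"
    if k: "k \<ge> 1" for k
  proof -
    let ?f = "\<lambda>u. ennreal (\<bar>u\<bar> ^ k) * indicator A u :: ennreal"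
    have meas: "?f \<in> borel_measurable borel" by measurable
    \<comment> \<open>A positive scale preserves the sign, so membership in the half-line depends on
      \<open>z\<close> alone.\<close>
    have scale: "indicator A (s \<omega> * z) = (indicator A z :: ennreal)" if "\<omega> \<in> space M" for \<omega> z
      using A s[OF that] by (auto simp: indicator_def zero_le_mult_iff mult_le_0_iff)
    have "ennreal ((d * c * exp (-3) * real k powr (\<theta> + 1/2)) ^ k) =
        ennreal (d ^ k) * (ennreal ((c * real k powr \<theta>) ^ k) * ennreal ((exp (-3) * sqrt (real k)) ^ k))"
      using powr_add_half_power[OF k, of "d * c" \<theta> "exp (-3)"] c(1) \<open>d > 0\<close>
      by (simp add: ennreal_mult'[symmetric] power_mult_distrib mult_ac)
    also have "\<dots> \<le> ennreal (d ^ k) * ((\<integral>\<^sup>+\<omega>. ennreal (\<bar>s \<omega>\<bar> ^ k) \<partial>M) * (\<integral>\<^sup>+z. ?f z \<partial>std_normal))"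
      by (intro mult_mono c std_normal_half_moment_ge k A) auto
    also have "(\<integral>\<^sup>+\<omega>. ennreal (\<bar>s \<omega>\<bar> ^ k) \<partial>M) * (\<integral>\<^sup>+z. ?f z \<partial>std_normal) =
          (\<integral>\<^sup>+\<omega>. ennreal (\<bar>s \<omega>\<bar> ^ k) * (\<integral>\<^sup>+z. ?f z \<partial>std_normal) \<partial>M)"
      by (intro nn_integral_multc[symmetric]) measurable
    also have "\<dots> = (\<integral>\<^sup>+\<omega>. \<integral>\<^sup>+z. ?f (s \<omega> * z) \<partial>std_normal \<partial>M)"
      by (intro nn_integral_cong, subst nn_integral_cmult[symmetric])
         (auto simp: abs_mult power_mult_distrib ennreal_mult' scale mult.assoc)
    also have "\<dots> = (\<integral>\<^sup>+\<omega>. ?f (G \<omega>) \<partial>M)"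
      by (rule mix_eq[OF meas, symmetric])
    also have "ennreal (d ^ k) * \<dots> = (\<integral>\<^sup>+\<omega>. ennreal (d ^ k) * ?f (G \<omega>) \<partial>M)"
      by (intro nn_integral_cmult[symmetric]) measurable
    also have "\<dots> \<le> (\<integral>\<^sup>+\<omega>. ennreal (\<bar>\<phi> (G \<omega>)\<bar> ^ k) \<partial>M)"
    proof (intro nn_integral_mono)
      fix \<omega>
      show "ennreal (d ^ k) * ?f (G \<omega>) \<le> ennreal (\<bar>\<phi> (G \<omega>)\<bar> ^ k)"
      proof (cases "G \<omega> \<in> A")
        case True
        have "(d * \<bar>G \<omega>\<bar>) ^ k \<le> \<bar>\<phi> (G \<omega>)\<bar> ^ k"
          using \<open>d > 0\<close> by (intro power_mono \<phi> True) auto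
        then show ?thesis
          using True \<open>d > 0\<close>
          by (simp add: ennreal_mult'[symmetric] power_mult_distrib ennreal_leI del: power_abs)
      qed simp
    qed
    finally show ?thesis .
  qed
  then show ?thesis
    unfolding moment_lower_def using c(1) \<open>d > 0\<close> by (intro exI[of _ "d * c * exp (-3)"]) auto
qed

section \<open>Units of the network\<close>

lemma param_indices_mono: "l \<le> l' \<Longrightarrow> param_indices l H \<subseteq> param_indices l' H"
  by (auto simp: param_indices_def)

text \<open>By recursion, layer \<open>l\<close> reads only the parameters of layers up to
  \<open>l\<close>. The parameter array can thus be replaced by its restriction to those indices, a
  block independent of the next layer.\<close>

lemma post_nonlin_cong:
  assumes "\<And>l' m i. (l', m, i) \<in> param_indices l H \<Longrightarrow> w l' m i = w' l' m i" "m \<in> {1..H l}"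
  shows "post_nonlin \<phi> H x w l m = post_nonlin \<phi> H x w' l m"
  using assms
proof (induction l arbitrary: m)
  case (Suc l)
  have "post_nonlin \<phi> H x w l i = post_nonlin \<phi> H x w' l i" if "i \<in> {1..H l}" for i
    using that param_indices_mono[of l "Suc l" H] by (intro Suc.IH Suc.prems(1)) auto
  moreover have "w (Suc l) m i = w' (Suc l) m i" if "i \<le> H l" for i
    using that Suc.prems by (auto simp: param_indices_def)
  ultimately have "affine (H l) (w (Suc l)) (post_nonlin \<phi> H x w l) m =
                   affine (H l) (w' (Suc l)) (post_nonlin \<phi> H x w' l) m"
    unfolding affine_def by (auto intro!: arg_cong2[where f="(+)"] sum.cong)
  then show ?case by simp
qed simp

text \<open>The space \<open>T\<close> is arbitrary because two are used: the probability space
  itself and the product space of the parameters of earlier layers.\<close>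

lemma measurable_post_nonlin:
  assumes "\<And>l' m i. (l', m, i) \<in> param_indices l H \<Longrightarrow> (\<lambda>y. w y l' m i) \<in> borel_measurable T"
    and [measurable]: "\<phi> \<in> borel_measurable borel" and "m \<in> {1..H l}"
  shows "(\<lambda>y. post_nonlin \<phi> H x (w y) l m) \<in> borel_measurable T"
  using assms(1,3)
proof (induction l arbitrary: m)
  case (Suc l)
  have [measurable]: "(\<lambda>y. post_nonlin \<phi> H x (w y) l i) \<in> borel_measurable T" if "i \<in> {1..H l}" for i
    using that param_indices_mono[of l "Suc l" H] by (intro Suc.IH Suc.prems(1)) auto
  have [measurable]: "(\<lambda>y. w y (Suc l) m i) \<in> borel_measurable T" if "i \<le> H l" for i
    using that Suc.prems by (auto simp: param_indices_def)
  show ?case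
    unfolding post_nonlin.simps affine_def by measurable
qed simp

locale gaussian_network = prob_space M for M :: "'a measure" +
  fixes W :: "nat \<Rightarrow> nat \<Rightarrow> nat \<Rightarrow> 'a \<Rightarrow> real"
    and \<phi> :: "real \<Rightarrow> real" and \<sigma> :: real and L :: nat
    and H :: "nat \<Rightarrow> nat" and x :: "nat \<Rightarrow> real"
  assumes H_pos: "l \<le> L \<Longrightarrow> H l \<ge> 1"
    and \<sigma>_pos: "\<sigma> > 0"
    and indep: "indep_vars (\<lambda>_. borel) (\<lambda>(l, m, i). W l m i) (param_indices L H)"
    and normal: "(l, m, i) \<in> param_indices L H \<Longrightarrow>
           distributed M lborel (W l m i) (normal_density 0 \<sigma>)"
    and \<phi>_measurable[measurable]: "\<phi> \<in> borel_measurable borel"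
    and envelope: "extended_envelope \<phi>"
begin

abbreviation pre_unit :: "nat \<Rightarrow> nat \<Rightarrow> 'a \<Rightarrow> real" where
  "pre_unit l m \<omega> \<equiv> pre_nonlin \<phi> H x (\<lambda>l m i. W l m i \<omega>) l m"

abbreviation post_unit :: "nat \<Rightarrow> nat \<Rightarrow> 'a \<Rightarrow> real" where
  "post_unit l m \<omega> \<equiv> post_nonlin \<phi> H x (\<lambda>l m i. W l m i \<omega>) l m"

text \<open>Coordinate 0 carries the constant that multiplies the bias, so the affine map becomes a
  single sum over \<open>{0..H l}\<close>.\<close>

definition augmented :: "nat \<Rightarrow> nat \<Rightarrow> 'a \<Rightarrow> real" where
  "augmented l i \<omega> = (if i = 0 then 1 else post_unit l i \<omega>)"

text \<open>Up to the factor \<sigma>, this is the conditional standard deviation of each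
  pre-nonlinearity of the next layer.\<close>

definition layer_norm :: "nat \<Rightarrow> 'a \<Rightarrow> real" where
  "layer_norm l \<omega> = L2_set (\<lambda>i. augmented l i \<omega>) {0..H l}"

lemma weight_measurable: "(l, m, i) \<in> param_indices L H \<Longrightarrow> W l m i \<in> borel_measurable M"
  using indep unfolding indep_vars_def by auto

lemma post_unit_measurable:
  assumes "l \<le> L" "m \<in> {1..H l}"
  shows "post_unit l m \<in> borel_measurable M"
  using assms param_indices_mono[OF assms(1), of H]
  by (intro measurable_post_nonlin weight_measurable) auto

lemma augmented_measurable:
  assumes "l \<le> L" "i \<le> H l"
  shows "augmented l i \<in> borel_measurable M"
proof (cases "i = 0")
  case False
  then have "augmented l i = post_unit l i"
    by (simp add: augmented_def fun_eq_iff)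
  then show ?thesis
    using assms False by (simp add: post_unit_measurable)
qed (simp add: augmented_def[abs_def])

lemma layer_norm_measurable:
  assumes "l \<le> L"
  shows "layer_norm l \<in> borel_measurable M"
proof -
  have [measurable]: "augmented l i \<in> borel_measurable M" if "i \<in> {0..H l}" for i
    using that assms by (intro augmented_measurable) auto
  show ?thesis
    unfolding layer_norm_def[abs_def] L2_set_def by measurable
qed

lemma layer_norm_ge_augmented:
  assumes "i \<le> H l"
  shows "\<bar>augmented l i \<omega>\<bar> \<le> layer_norm l \<omega>"
proof -
  have "\<bar>augmented l i \<omega>\<bar> \<le> L2_set (\<lambda>i. \<bar>augmented l i \<omega>\<bar>) {0..H l}"
    using assms by (intro member_le_L2_set) auto
  then show ?thesis by (simp add: layer_norm_def L2_set_def)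
qed

text \<open>One row of parameters of layer \<open>Suc l\<close> and the parameters of all layers up
  to \<open>l\<close> have disjoint indices, hence form independent blocks; the augmented layer
  \<open>l\<close> is a function of the second block.\<close>

lemma pre_unit_scale_mixture:
  assumes "l < L" "m \<in> {1..H (Suc l)}"
  shows "normal_scale_mixture M (pre_unit (Suc l) m) (\<lambda>\<omega>. \<sigma> * layer_norm l \<omega>)"
proof -
  let ?V = "\<lambda>(l, m, i). W l m i"
  define I where "I = (\<lambda>i. (Suc l, m, i)) ` {0..H l}"
  define B where "B = param_indices l H"
  define Y where "Y = (\<lambda>\<omega>. \<lambda>p\<in>B. ?V p \<omega>)"
  \<comment> \<open>The augmented units are recomputed from an array indexed by \<open>B\<close>:
    the coefficients must be functions on the product space in which \<open>Y\<close> takes its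
    values.\<close>
  define a :: "nat \<times> nat \<times> nat \<Rightarrow> (nat \<times> nat \<times> nat \<Rightarrow> real) \<Rightarrow> real" where
    "a = (\<lambda>(_, _, i) y. if i = 0 then 1 else post_nonlin \<phi> H x (\<lambda>l m i. y (l, m, i)) l i)"
  have I: "I \<subseteq> param_indices L H" using assms by (auto simp: I_def param_indices_def)
  have B: "B \<subseteq> param_indices L H" unfolding B_def using assms by (intro param_indices_mono) auto
  have IB: "I \<inter> B = {}" by (auto simp: I_def B_def param_indices_def)
  have mix: "normal_scale_mixture M (\<lambda>\<omega>. \<Sum>p\<in>I. ?V p \<omega> * a p (Y \<omega>)) (\<lambda>\<omega>. \<sigma> * sqrt (\<Sum>p\<in>I. (a p (Y \<omega>))\<^sup>2))"
  proof (rule normal_scale_mixture_linear_form[where V = ?V and a = a and Y = Y])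
    show "indep_vars (\<lambda>_. borel) ?V I" by (rule indep_vars_subset[OF indep I])
    show "indep_var (PiM I (\<lambda>_. borel)) (\<lambda>\<omega>. \<lambda>p\<in>I. ?V p \<omega>) (PiM B (\<lambda>_. borel)) Y"
      unfolding Y_def by (rule indep_var_restrict[OF indep IB I B])
    show "a p \<in> borel_measurable (PiM B (\<lambda>_. borel))" if "p \<in> I" for p
    proof -
      obtain i where p: "p = (Suc l, m, i)" and i: "i \<le> H l" using \<open>p \<in> I\<close> by (auto simp: I_def)
      show ?thesis
      proof (cases "i = 0")
        case False
        then have "a p = (\<lambda>y. post_nonlin \<phi> H x (\<lambda>l m i. y (l, m, i)) l i)"
          by (simp add: a_def p)
        then show ?thesis
          using i False unfolding B_def by (auto intro!: measurable_post_nonlin)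
      qed (simp add: a_def p)
    qed
    show "(Suc l, m, 0) \<in> I" by (auto simp: I_def)
    show "a (Suc l, m, 0) y = 1" for y by (simp add: a_def)
    fix p assume "p \<in> I"
    then show "distributed M lborel (?V p) (normal_density 0 \<sigma>)"
      using I normal by (cases p) auto
  qed (simp_all add: I_def \<sigma>_pos)
  \<comment> \<open>\<open>Y\<close> is \<open>undefined\<close> outside \<open>B\<close>, which is
    harmless because layer \<open>l\<close> reads only indices in \<open>B\<close>.\<close>
  have aug: "a (Suc l, m, i) (Y \<omega>) = augmented l i \<omega>" if "i \<le> H l" for i \<omega>
  proof (cases "i = 0")
    case False
    then show ?thesis
      using that by (auto simp: a_def augmented_def Y_def B_def intro!: post_nonlin_cong)
  qed (simp add: a_def augmented_def)
  have inj: "inj_on (\<lambda>i. (Suc l, m, i)) {0..H l}" by (simp add: inj_on_def)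
  have "(\<Sum>p\<in>I. ?V p \<omega> * a p (Y \<omega>)) = pre_unit (Suc l) m \<omega>" for \<omega>
  proof -
    have "(\<Sum>p\<in>I. ?V p \<omega> * a p (Y \<omega>)) = (\<Sum>i\<in>{0..H l}. W (Suc l) m i \<omega> * augmented l i \<omega>)"
      unfolding I_def sum.reindex[OF inj] by (intro sum.cong) (auto simp: aug)
    also have "\<dots> = W (Suc l) m 0 \<omega> + (\<Sum>i=1..H l. W (Suc l) m i \<omega> * augmented l i \<omega>)"
      by (subst sum.atLeast_Suc_atMost) (auto simp: augmented_def)
    also have "\<dots> = pre_unit (Suc l) m \<omega>"
      unfolding pre_nonlin_def affine_def
      by (auto simp: augmented_def intro!: sum.cong)
    finally show ?thesis .
  qed
  moreover have "sqrt (\<Sum>p\<in>I. (a p (Y \<omega>))\<^sup>2) = layer_norm l \<omega>" for \<omega>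
    unfolding I_def sum.reindex[OF inj] layer_norm_def L2_set_def
    by (intro arg_cong[where f=sqrt] sum.cong) (auto simp: aug)
  ultimately show ?thesis using mix by simp
qed

lemma pre_unit_measurable:
  assumes "l < L" "m \<in> {1..H (Suc l)}"
  shows "pre_unit (Suc l) m \<in> borel_measurable M"
  using pre_unit_scale_mixture[OF assms] by (simp add: normal_scale_mixture_def)

section \<open>Induction over the layers\<close>

text \<open>The scale mixture adds 1/2 to the exponent, and the linear envelope keeps it under
  \<phi>. The lower bound for the post-nonlinearity is taken from the mixture directly, since a
  lower moment bound for the pre-nonlinearity would not tell which half-line carries it.\<close>

lemma unit_moments:
  assumes l: "l < L" and m: "m \<in> {1..H (Suc l)}"
    and up: "moment_upper M (layer_norm l) (real l / 2)"
    and lo: "moment_lower M (layer_norm l) (real l / 2)"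
  shows "moment_upper M (pre_unit (Suc l) m) (real (Suc l) / 2)"
    and "moment_lower M (pre_unit (Suc l) m) (real (Suc l) / 2)"
    and "moment_upper M (post_unit (Suc l) m) (real (Suc l) / 2)"
    and "moment_lower M (post_unit (Suc l) m) (real (Suc l) / 2)"
proof -
  have [measurable]: "layer_norm l \<in> borel_measurable M"
    using l by (intro layer_norm_measurable) simp
  have [measurable]: "pre_unit (Suc l) m \<in> borel_measurable M"
    by (rule pre_unit_measurable[OF l m])
  note mix = pre_unit_scale_mixture[OF l m]
  have \<theta>: "real (Suc l) / 2 = real l / 2 + 1 / 2" by simp
  have post: "post_unit (Suc l) m = (\<lambda>\<omega>. \<phi> (pre_unit (Suc l) m \<omega>))"
    by (simp add: post_nonlin_eq del: post_nonlin.simps)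
  have sup: "moment_upper M (\<lambda>\<omega>. \<sigma> * layer_norm l \<omega>) (real l / 2)"
    using \<sigma>_pos by (intro moment_upper_mono[OF up, of \<sigma>]) (auto simp: abs_mult)
  have slo: "moment_lower M (\<lambda>\<omega>. \<sigma> * layer_norm l \<omega>) (real l / 2)"
    using \<sigma>_pos by (intro moment_lower_mono[OF lo, of \<sigma>]) (auto simp: abs_mult)
  show pre_up: "moment_upper M (pre_unit (Suc l) m) (real (Suc l) / 2)"
    unfolding \<theta> by (rule normal_scale_mixture_moment_upper[OF mix sup])
  \<comment> \<open>The identity takes the place of \<phi>, with \<open>d = 1\<close> on the
    positive half-line.\<close>
  show "moment_lower M (pre_unit (Suc l) m) (real (Suc l) / 2)"
    unfolding \<theta>
    using normal_scale_mixture_moment_lower[OF mix slo, of "{0..}" 1 "\<lambda>u. u"] by simp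
  obtain c1 c2 d1 d2 where e: "c1 \<ge> 0" "c2 \<ge> 0" "d1 > 0" "d2 > 0"
      "(\<forall>u\<ge>0. \<bar>\<phi> u\<bar> \<ge> c1 + d1 * \<bar>u\<bar>) \<or> (\<forall>u\<le>0. \<bar>\<phi> u\<bar> \<ge> c1 + d1 * \<bar>u\<bar>)"
      "\<And>u. \<bar>\<phi> u\<bar> \<le> c2 + d2 * \<bar>u\<bar>"
    using envelope unfolding extended_envelope_def by blast
  obtain A where A: "A = {0..} \<or> A = {..(0::real)}" "\<And>u. u \<in> A \<Longrightarrow> c1 + d1 * \<bar>u\<bar> \<le> \<bar>\<phi> u\<bar>"
    using e(5) by (metis atLeast_iff atMost_iff)
  show "moment_lower M (post_unit (Suc l) m) (real (Suc l) / 2)"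
    unfolding \<theta> post
  proof (rule normal_scale_mixture_moment_lower[OF mix slo A(1) e(3)])
    show "d1 * \<bar>u\<bar> \<le> \<bar>\<phi> u\<bar>" if "u \<in> A" for u
      using A(2)[OF that] e(1) by linarith
  qed
  have "moment_upper M (\<lambda>\<omega>. d2 * \<bar>pre_unit (Suc l) m \<omega>\<bar>) (real (Suc l) / 2)"
    using e(4) by (intro moment_upper_mono[OF pre_up, of d2]) (auto simp: abs_mult)
  \<comment> \<open>The additive constant \<open>c2\<close> does not change the order, as constants
    satisfy every upper bound with nonnegative exponent.\<close>
  then have "moment_upper M (\<lambda>\<omega>. c2 + d2 * \<bar>pre_unit (Suc l) m \<omega>\<bar>) (real (Suc l) / 2)"
    by (intro moment_upper_add moment_upper_const) auto
  then show "moment_upper M (post_unit (Suc l) m) (real (Suc l) / 2)"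
    unfolding post
  proof (rule moment_upper_mono[where c=1])
    fix \<omega>
    show "\<bar>\<phi> (pre_unit (Suc l) m \<omega>)\<bar> \<le> 1 * \<bar>c2 + d2 * \<bar>pre_unit (Suc l) m \<omega>\<bar>\<bar>"
      unfolding mult_1 using e(6) abs_ge_self by (rule order.trans)
  qed auto
qed

text \<open>From above, the Euclidean norm is at most the sum of the absolute coordinates, a finite
  sum of variables satisfying the same bound. From below, it dominates any single unit of the layer,
  and one exists because the width is at least 1.\<close>

lemma layer_norm_moments:
  assumes "l \<le> L"
  shows "moment_upper M (layer_norm l) (real l / 2) \<and> moment_lower M (layer_norm l) (real l / 2)"
  using assms
proof (induction l)
  case 0
  define r where "r = L2_set (\<lambda>i. if i = 0 then 1 else x i) {0..H 0}"
  have r: "layer_norm 0 = (\<lambda>_. r)"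
    by (simp add: fun_eq_iff layer_norm_def augmented_def r_def cong: if_cong)
  \<comment> \<open>The constant coordinate alone gives this, even for the zero input.\<close>
  have "r \<ge> 1"
    unfolding r_def using member_le_L2_set[of "{0..H 0}" 0 "\<lambda>i. if i = 0 then 1 else x i"] by simp
  then show ?case
    unfolding r using moment_upper_const[of 0 r] moment_lower_const[of r] by simp
next
  case (Suc l)
  then have l: "l < L" by simp
  have IH: "moment_upper M (layer_norm l) (real l / 2)" "moment_lower M (layer_norm l) (real l / 2)"
    using Suc by auto
  have meas: "augmented (Suc l) i \<in> borel_measurable M" if "i \<le> H (Suc l)" for i
    using Suc.prems that by (rule augmented_measurable)
  have aug: "moment_upper M (augmented (Suc l) i) (real (Suc l) / 2)" if "i \<le> H (Suc l)" for i
  proof (cases "i = 0")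
    case False
    then have "augmented (Suc l) i = post_unit (Suc l) i"
      by (simp add: augmented_def fun_eq_iff)
    then show ?thesis
      using False that unit_moments(3)[OF l _ IH, of i] by simp
  next
    case True
    then have "augmented (Suc l) i = (\<lambda>_. 1)"
      by (simp add: augmented_def fun_eq_iff)
    then show ?thesis
      using moment_upper_const[of "real (Suc l) / 2" 1] by simp
  qed
  have abs: "moment_upper M (\<lambda>\<omega>. \<bar>augmented (Suc l) i \<omega>\<bar>) (real (Suc l) / 2)" if "i \<le> H (Suc l)" for i
    using aug[OF that] by (simp add: moment_upper_def)
  have abs_meas: "(\<lambda>\<omega>. \<bar>augmented (Suc l) i \<omega>\<bar>) \<in> borel_measurable M" if "i \<le> H (Suc l)" for i
    using meas[OF that] by measurable
  have "moment_upper M (\<lambda>\<omega>. \<Sum>i=0..H (Suc l). \<bar>augmented (Suc l) i \<omega>\<bar>) (real (Suc l) / 2)"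
    by (intro moment_upper_sum abs abs_meas) auto
  then have "moment_upper M (layer_norm (Suc l)) (real (Suc l) / 2)"
  proof (rule moment_upper_mono[where c=1])
    show "(\<lambda>\<omega>. \<Sum>i=0..H (Suc l). \<bar>augmented (Suc l) i \<omega>\<bar>) \<in> borel_measurable M"
      by (intro borel_measurable_sum abs_meas) auto
    show "\<bar>layer_norm (Suc l) \<omega>\<bar> \<le> 1 * \<bar>\<Sum>i=0..H (Suc l). \<bar>augmented (Suc l) i \<omega>\<bar>\<bar>" for \<omega>
      using L2_set_le_sum_abs[of "\<lambda>i. augmented (Suc l) i \<omega>" "{0..H (Suc l)}"]
      by (simp add: layer_norm_def sum_nonneg)
  qed auto
  moreover have "moment_lower M (layer_norm (Suc l)) (real (Suc l) / 2)"
  proof (rule moment_lower_mono[where c=1])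
    have one: "1 \<in> {1..H (Suc l)}" using H_pos[OF Suc.prems] by simp
    show "moment_lower M (post_unit (Suc l) 1) (real (Suc l) / 2)"
      by (rule unit_moments(4)[OF l one IH])
    show "post_unit (Suc l) 1 \<in> borel_measurable M"
      by (rule post_unit_measurable[OF Suc.prems one])
    show "1 * \<bar>post_unit (Suc l) 1 \<omega>\<bar> \<le> \<bar>layer_norm (Suc l) \<omega>\<bar>" for \<omega>
      using layer_norm_ge_augmented[of 1 "Suc l" \<omega>] one by (simp add: augmented_def)
  qed simp
  ultimately show ?case by simp
qed

lemma units_sub_weibull:
  assumes "l \<in> {1..L}" "m \<in> {1..H l}" "U \<in> {pre_unit l m, post_unit l m}"
  shows "sub_weibull M U (real l / 2) \<and> sub_weibull_optimal M U (real l / 2)"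
proof -
  \<comment> \<open>Layer \<open>l\<close> is driven by the norm of layer \<open>l - 1\<close>, of
    exponent (l - 1)/2; this shift gives the first layer the exponent 1/2.\<close>
  obtain k where k: "l = Suc k" "k < L" using assms(1) by (cases l) auto
  have m: "m \<in> {1..H (Suc k)}" using assms(2) k by simp
  have bounds: "moment_upper M (layer_norm k) (real k / 2)" "moment_lower M (layer_norm k) (real k / 2)"
    using layer_norm_moments[of k] k by auto
  have "moment_upper M U (real l / 2)" "moment_lower M U (real l / 2)"
    using assms(3) unit_moments[OF k(2) m bounds] k(1) by auto
  moreover have "U \<in> borel_measurable M"
    using assms(3) pre_unit_measurable[OF k(2) m] post_unit_measurable[of l m] assms(1,2) k(1) by auto
  ultimately show ?thesis
    using k(1) by (intro conjI moment_upper_imp_sub_weibull moment_bounds_imp_sub_weibull_optimal) auto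
qed

end

theorem theorem3p1:
  fixes M :: "'a measure"
    and W :: "nat \<Rightarrow> nat \<Rightarrow> nat \<Rightarrow> 'a \<Rightarrow> real"
    and \<phi> :: "real \<Rightarrow> real"
    and \<sigma> :: real
    and L :: nat
    and H :: "nat \<Rightarrow> nat"
    and x :: "nat \<Rightarrow> real"
  assumes "prob_space M"
    and "L \<ge> 1"
    and "\<And>l. l \<le> L \<Longrightarrow> H l \<ge> 1"
    and "\<sigma> > 0"
    and "prob_space.indep_vars M (\<lambda>_. borel) (\<lambda>(l, m, i). W l m i) (param_indices L H)"
    and "\<And>l m i. (l, m, i) \<in> param_indices L H \<Longrightarrow>
           distributed M lborel (W l m i) (normal_density 0 \<sigma>)"
    and "\<phi> \<in> borel_measurable borel"
    and "extended_envelope \<phi>"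
  shows "\<forall>l\<in>{1..L}. \<forall>m\<in>{1..H l}.
           \<forall>U \<in> {\<lambda>\<omega>. pre_nonlin \<phi> H x (\<lambda>l m i. W l m i \<omega>) l m,
                 \<lambda>\<omega>. post_nonlin \<phi> H x (\<lambda>l m i. W l m i \<omega>) l m}.
             sub_weibull M U (real l / 2) \<and> sub_weibull_optimal M U (real l / 2)"
proof -
  interpret prob_space M by fact
  interpret gaussian_network M W \<phi> \<sigma> L H x
    by unfold_locales (use assms in auto)
  show ?thesis
    by (intro ballI units_sub_weibull)
qed

end
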